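(* Let $\delta,\kappa,\lambda>0$ and $\mu\ge 0$ be constants, $h(x)=\kappa x^2+\mu$ and $g(x)=\lambda x^2$, and suppose that $\delta\lambda-\kappa>0$. The equation $$\tanh\big(\sqrt{2\delta}\,\alpha\big)=\frac{\sqrt{2\delta}\,(\delta\lambda-\kappa)\,\alpha}{\delta(\delta\lambda-\kappa)\alpha^2-(\kappa+\delta\mu)}$$ has a unique solution $\alpha>0$, which is strictly greater than $\sqrt{\frac{\kappa+\delta\mu}{\delta(\delta\lambda-\kappa)}}$. This solution is less than or equal to $\frac{1}{2\lambda}$ if and only if $$\frac{1}{2\lambda}>\sqrt{\frac{\kappa+\delta\mu}{\delta(\delta\lambda-\kappa)}}\quad\text{and}\quad\tanh\frac{\sqrt{2\delta}}{2\lambda}\ge\frac{\sqrt{2\delta}\,(\delta\lambda-\kappa)\lambda}{\delta(\delta\lambda-\kappa)-4(\kappa+\delta\mu)\lambda^2},$$ in which case the function $$u(x)=\begin{cases}A\cosh(\sqrt{2\delta}\,x)+\dfrac{\kappa}{\delta}x^2+\dfrac{\kappa+\delta\mu}{\delta^2},&|x|\le\alpha,\\[4pt] \lambda x^2,&\alpha<|x|\le\dfrac1{2\lambda},\\[4pt] |x|-\dfrac{1}{4\lambda},&|x|>\dfrac{1}{2\lambda},\end{cases}\qquad A=\frac{\delta(\delta\lambda-\kappa)\alpha^2-(\kappa+\delta\mu)}{\delta^2\cosh(\sqrt{2\delta}\,\alpha)}>0,$$ is a candidate for the value function (as defined in the context).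
   Context: Candidate for the value function (for the data $b\equiv0$, $\sigma\equiv1$, constant discount rate $\delta$, running payoff $h(x)=\kappa x^2+\mu$, terminal payoff $g(x)=\lambda x^2$). Let $\mathcal{L}u(x)=\frac12u''(x)-\delta u(x)$. A candidate is a continuous $u:\mathbb{R}\to\mathbb{R}_+$ that is $C^1$ with absolutely continuous first derivative inside $\mathbb{R}\setminus\mathcal{B}$, where $\mathcal{B}$ is a finite set, that satisfies $|u'(x)|\le 1$ for all $x\in\mathbb{R}\setminus\mathcal{B}$, and that has properties (i)–(iii) below, where $\mathcal{C}=\mathrm{cl}\big[\mathrm{int}\{x\in\mathbb{R}\setminus\mathcal{B}: |u'(x)|=1\}\big]$, $\mathcal{S}_{\mathcal W}=\{x\in\mathbb{R}: u(x)=g(x)\}$, $\mathcal{S}_{\mathcal C}=\mathrm{cl}\{x\in\mathbb{R}: u(x)<g(x)\}$, $\mathcal{S}=\mathcal{S}_{\mathcal W}\cup\mathcal{S}_{\mathcal C}$, $\mathcal{W}=\mathbb{R}\setminus(\mathcal{C}\cup\mathcal{S})$ (int and cl denote interior and closure): (i) each of $\mathcal{C},\mathcal{S}_{\mathcal W},\mathcal{S}_{\mathcal C}$ is a finite union of intervals, and $\mathcal{B}\subseteq\mathcal{S}_{\mathcal C}\subseteq\mathcal{C}$; (ii) $\mathcal{L}u+h=0$ Lebesgue-a.e. in $\mathcal{W}$; $\mathcal{L}u+h\ge0$ Lebesgue-a.e. in $\mathrm{int}(\mathcal{C}\setminus\mathcal{S})$; $\mathcal{L}u+h=\mathcal{L}g+h\le0$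 Lebesgue-a.e. in $\mathrm{int}\,\mathcal{S}_{\mathcal W}$; and $\mathcal{L}u+h\in\mathbb{R}$ (no sign condition) Lebesgue-a.e. in $\mathrm{int}\,\mathcal{S}_{\mathcal C}\setminus\mathcal{B}$; (iii) for every $c\in\mathcal{B}$, with $u'_-(c)$, $u'_+(c)$ the left-hand and right-hand derivatives of $u$ at $c$, either $u'_-(c)=1$ and $u'_+(c)<1$, or $u'_-(c)>-1$ and $u'_+(c)=-1$.
   Formalization: In the criterion for α ≤ 1/(2λ), the numerator √(2δ)(δλ−κ)λ is corrected to √(2δ)(δλ−κ)·2λ; as printed it fails, e.g. δ=1/2, λ=1/4, μ=0 and a suitable κ, where it holds but α = 2 ln 3 > 2 = 1/(2λ). *)

theory Defs
  imports "HOL-Analysis.Analysis"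
begin

section \<open>Candidates for the value function\<close>

definition abs_cont_on_interval :: "(real \<Rightarrow> real) \<Rightarrow> real \<Rightarrow> real \<Rightarrow> bool" where
  "abs_cont_on_interval f a b \<longleftrightarrow>
    (\<forall>e>0. \<exists>d>0. \<forall>(n::nat) s t.
       (\<forall>i<n. a \<le> s i \<and> s i \<le> t i \<and> t i \<le> b) \<and>
       (\<forall>i<n. \<forall>j<n. i \<noteq> j \<longrightarrow> {s i<..<t i} \<inter> {s j<..<t j} = {}) \<and>
       (\<Sum>i<n. t i - s i) < d \<longrightarrow>
       (\<Sum>i<n. \<bar>f (t i) - f (s i)\<bar>) < e)"

(* Absolute continuity inside an open set: on every compact interval contained in it. *)
definition abs_cont_inside :: "real set \<Rightarrow> (real \<Rightarrow> real) \<Rightarrow> bool" where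
  "abs_cont_inside U f \<longleftrightarrow> (\<forall>a b. a \<le> b \<and> {a..b} \<subseteq> U \<longrightarrow> abs_cont_on_interval f a b)"

definition C1_abs_cont_inside :: "real set \<Rightarrow> (real \<Rightarrow> real) \<Rightarrow> bool" where
  "C1_abs_cont_inside U u \<longleftrightarrow>
    (\<forall>x\<in>U. u differentiable (at x)) \<and> continuous_on U (deriv u) \<and> abs_cont_inside U (deriv u)"

definition finite_union_of_intervals :: "real set \<Rightarrow> bool" where
  "finite_union_of_intervals S \<longleftrightarrow> (\<exists>F. finite F \<and> (\<forall>I\<in>F. is_interval I) \<and> S = \<Union>F)"

(* deriv is total, so the existence of u''(x) must be required separately wherever Lop u x is used. *)
definition has_second_deriv :: "(real \<Rightarrow> real) \<Rightarrow> real \<Rightarrow> bool" where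
  "has_second_deriv u x \<longleftrightarrow>
    (\<forall>\<^sub>F y in nhds x. u differentiable (at y)) \<and> deriv u differentiable (at x)"

definition Lop :: "real \<Rightarrow> (real \<Rightarrow> real) \<Rightarrow> real \<Rightarrow> real" where
  "Lop \<delta> u x = 1/2 * deriv (deriv u) x - \<delta> * u x"

definition region_C :: "real set \<Rightarrow> (real \<Rightarrow> real) \<Rightarrow> real set" where
  "region_C B u = closure (interior {x \<in> UNIV - B. \<bar>deriv u x\<bar> = 1})"

definition region_SW :: "(real \<Rightarrow> real) \<Rightarrow> (real \<Rightarrow> real) \<Rightarrow> real set" where
  "region_SW g u = {x. u x = g x}"

definition region_SC :: "(real \<Rightarrow> real) \<Rightarrow> (real \<Rightarrow> real) \<Rightarrow> real set" where
  "region_SC g u = closure {x. u x < g x}"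

definition region_S :: "(real \<Rightarrow> real) \<Rightarrow> (real \<Rightarrow> real) \<Rightarrow> real set" where
  "region_S g u = region_SW g u \<union> region_SC g u"

definition region_W :: "real set \<Rightarrow> (real \<Rightarrow> real) \<Rightarrow> (real \<Rightarrow> real) \<Rightarrow> real set" where
  "region_W B g u = UNIV - (region_C B u \<union> region_S g u)"

definition candidate_with ::
    "real set \<Rightarrow> real \<Rightarrow> (real \<Rightarrow> real) \<Rightarrow> (real \<Rightarrow> real) \<Rightarrow> (real \<Rightarrow> real) \<Rightarrow> bool" where
  "candidate_with B \<delta> h g u \<longleftrightarrow>
     finite B \<and> continuous_on UNIV u \<and> (\<forall>x. 0 \<le> u x) \<and>
     C1_abs_cont_inside (UNIV - B) u \<and>
     (\<forall>x\<in>UNIV - B. \<bar>deriv u x\<bar> \<le> 1) \<and>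
     finite_union_of_intervals (region_C B u) \<and>
     finite_union_of_intervals (region_SW g u) \<and>
     finite_union_of_intervals (region_SC g u) \<and>
     B \<subseteq> region_SC g u \<and> region_SC g u \<subseteq> region_C B u \<and>
     (AE x in lebesgue. x \<in> region_W B g u \<longrightarrow>
        has_second_deriv u x \<and> Lop \<delta> u x + h x = 0) \<and>
     (AE x in lebesgue. x \<in> interior (region_C B u - region_S g u) \<longrightarrow>
        has_second_deriv u x \<and> Lop \<delta> u x + h x \<ge> 0) \<and>
     (AE x in lebesgue. x \<in> interior (region_SW g u) \<longrightarrow>
        has_second_deriv u x \<and> has_second_deriv g x \<and>
        Lop \<delta> u x + h x = Lop \<delta> g x + h x \<and> Lop \<delta> g x + h x \<le> 0) \<and>
     (AE x in lebesgue. x \<in> interior (region_SC g u) - B \<longrightarrow> has_second_deriv u x) \<and>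
     (\<forall>c\<in>B. \<exists>dl dr.
        (u has_real_derivative dl) (at_left c) \<and> (u has_real_derivative dr) (at_right c) \<and>
        (dl = 1 \<and> dr < 1 \<or> dl > -1 \<and> dr = -1))"

definition candidate :: "real \<Rightarrow> (real \<Rightarrow> real) \<Rightarrow> (real \<Rightarrow> real) \<Rightarrow> (real \<Rightarrow> real) \<Rightarrow> bool" where
  "candidate \<delta> h g u \<longleftrightarrow> (\<exists>B. candidate_with B \<delta> h g u)"

section \<open>Quadratic data\<close>

definition h_quad :: "real \<Rightarrow> real \<Rightarrow> real \<Rightarrow> real" where
  "h_quad \<kappa> \<mu> x = \<kappa> * x\<^sup>2 + \<mu>"

definition g_quad :: "real \<Rightarrow> real \<Rightarrow> real" where
  "g_quad lam x = lam * x\<^sup>2"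

(* If the denominator vanishes, the quotient is 0 by convention; as tanh is positive on
   the positive half-line, this produces no spurious positive solutions. *)
definition alpha_eq :: "real \<Rightarrow> real \<Rightarrow> real \<Rightarrow> real \<Rightarrow> real \<Rightarrow> bool" where
  "alpha_eq \<delta> \<kappa> lam \<mu> \<alpha> \<longleftrightarrow>
     tanh (sqrt (2*\<delta>) * \<alpha>) =
       sqrt (2*\<delta>) * (\<delta>*lam - \<kappa>) * \<alpha> / (\<delta> * (\<delta>*lam - \<kappa>) * \<alpha>\<^sup>2 - (\<kappa> + \<delta>*\<mu>))"

definition A_const :: "real \<Rightarrow> real \<Rightarrow> real \<Rightarrow> real \<Rightarrow> real \<Rightarrow> real" where
  "A_const \<delta> \<kappa> lam \<mu> \<alpha> =
     (\<delta> * (\<delta>*lam - \<kappa>) * \<alpha>\<^sup>2 - (\<kappa> + \<delta>*\<mu>)) / (\<delta>\<^sup>2 * cosh (sqrt (2*\<delta>) * \<alpha>))"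

definition u_quad :: "real \<Rightarrow> real \<Rightarrow> real \<Rightarrow> real \<Rightarrow> real \<Rightarrow> real \<Rightarrow> real" where
  "u_quad \<delta> \<kappa> lam \<mu> \<alpha> x =
     (if \<bar>x\<bar> \<le> \<alpha>
      then A_const \<delta> \<kappa> lam \<mu> \<alpha> * cosh (sqrt (2*\<delta>) * x) + \<kappa>/\<delta> * x\<^sup>2 + (\<kappa> + \<delta>*\<mu>)/\<delta>\<^sup>2
      else if \<bar>x\<bar> \<le> 1/(2*lam) then lam * x\<^sup>2
      else \<bar>x\<bar> - 1/(4*lam))"

(* Evaluating the right-hand side of the equation for \<alpha> at 1/(2*lam) gives the numerator
   sqrt (2*\<delta>) * (\<delta>*lam - \<kappa>) * (2*lam). The lemma shows that the factor 2 cannot be dropped: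
   with the numerator sqrt (2*\<delta>) * (\<delta>*lam - \<kappa>) * lam, which appears in the source,
   both inequalities of the criterion can hold although the solution exceeds 1/(2*lam). *)
lemma criterion_without_factor_2_fails:
  "\<exists>\<delta> \<kappa> lam \<mu> \<alpha> :: real. \<delta> > 0 \<and> \<kappa> > 0 \<and> lam > 0 \<and> \<mu> \<ge> 0 \<and> \<delta>*lam - \<kappa> > 0 \<and>
     \<alpha> > 0 \<and> alpha_eq \<delta> \<kappa> lam \<mu> \<alpha> \<and> \<alpha> > 1/(2*lam) \<and>
     1/(2*lam) > sqrt ((\<kappa> + \<delta>*\<mu>) / (\<delta> * (\<delta>*lam - \<kappa>))) \<and>
     tanh (sqrt (2*\<delta>) / (2*lam)) \<ge>
       sqrt (2*\<delta>) * (\<delta>*lam - \<kappa>) * lam / (\<delta> * (\<delta>*lam - \<kappa>) - 4 * (\<kappa> + \<delta>*\<mu>) * lam\<^sup>2)"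
proof -
  define L :: real where "L = ln 3"
  define c where "c = 2 * L * (L - 41/40)"
  define m where "m = (1/8) / (1 + c)"
  define k where "k = c * m"
  have L1: "L > 41/40"
  proof -
    have "exp (41/40::real) ^ 40 = exp 1 ^ 41" by (simp flip: exp_of_nat_mult)
    also have "\<dots> < (272/100) ^ 41" using e_less_272 by (intro power_strict_mono) auto
    also have "\<dots> < (3::real) ^ 40" by (simp add: power_divide)
    finally have "exp (41/40::real) < 3" by (rule power_less_imp_less_base) simp
    thus ?thesis unfolding L_def by (metis exp_gt_zero exp_ln exp_less_cancel_iff less_trans)
  qed
  have L2: "L < 6/5"
  proof -
    have "(3::real)^5 < (27/10)^6" by (simp add: power_divide)
    also have "\<dots> < exp 1 ^ 6" using e_approx_32 by (intro power_strict_mono) (auto simp: abs_if split: if_splits)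
    also have "\<dots> = exp (6/5) ^ 5" by (simp flip: exp_of_nat_mult)
    finally have "3 < exp (6/5::real)" by (rule power_less_imp_less_base) simp
    thus ?thesis unfolding L_def by (metis exp_ln exp_less_cancel_iff zero_less_numeral)
  qed
  have c0: "c > 0" using L1 by (simp add: c_def)
  have "c \<le> (12/5) * (7/40)" unfolding c_def using L1 L2 by (intro mult_mono) auto
  hence c1: "c < 1/2" by simp
  have m0: "m > 0" using c0 by (simp add: m_def)
  have k0: "k > 0" using c0 m0 by (simp add: k_def)
  have mk: "1/8 - k = m" using c0 by (simp add: k_def m_def field_simps)
  have t: "tanh (2 * L) = 40/41"
  proof -
    have "2 * L = ln (9::real)"
      using ln_realpow[of "3::real" 2] by (simp add: L_def)
    thus ?thesis by (simp add: tanh_ln_real)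
  qed
  have "alpha_eq (1/2) k (1/4) 0 (2 * L)"
  proof -
    have "1/2 * m * (2 * L)\<^sup>2 - k = m * (2 * L) * (41/40)"
      by (simp add: k_def c_def power2_eq_square algebra_simps)
    moreover have "m * (2 * L) / (m * (2 * L) * (41/40)) = tanh (2 * L)"
      unfolding t using m0 L1 by simp
    moreover have "(1/2) * (1/4) - k = m" using mk by simp
    ultimately have "tanh (1 * (2 * L)) =
        1 * ((1/2) * (1/4) - k) * (2 * L) / (1/2 * ((1/2) * (1/4) - k) * (2 * L)\<^sup>2 - (k + 1/2 * 0))"
      by (simp only: mult_1 mult_zero_right add_0_right)
    moreover have "sqrt (2 * (1/2)) = (1::real)" by simp
    ultimately show ?thesis unfolding alpha_eq_def by (simp only:)
  qed
  moreover have "sqrt (k / (m/2)) < 2"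
    using c1 m0 by (intro real_less_lsqrt) (auto simp: k_def)
  moreover have "m * (1/4) / (m/2 - k/4) \<le> tanh 2"
  proof -
    have "m * (1/4) / (m/2 - k/4) = 1 / (2 - c)"
      using m0 c1 by (simp add: k_def divide_simps) (simp add: algebra_simps)
    also have "\<dots> \<le> 8/10" using c1 by (simp add: divide_simps)
    also have "\<dots> = tanh L" by (simp add: L_def tanh_ln_real)
    also have "\<dots> \<le> tanh 2" using L2 by simp
    finally show ?thesis .
  qed
  ultimately show ?thesis
    using L1 m0 k0 mk
    by (intro exI[of _ "1/2"] exI[of _ k] exI[of _ "1/4"] exI[of _ 0] exI[of _ "2 * L"])
       (simp add: power2_eq_square)
qed

end

theory Submission
  imports Defs
begin

text \<open>
  Write \<open>p = \<delta>\<lambda> - \<kappa>\<close>, \<open>q = \<kappa> + \<delta>\<mu>\<close>, \<open>r = \<surd>(2\<delta>)\<close>, \<open>b = 1/(2\<lambda>)\<close>.  A positive solution of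
  \<open>tanh (r \<alpha>) = r p \<alpha> / (\<delta> p \<alpha>\<^sup>2 - q)\<close> makes the denominator positive, because \<open>tanh\<close>
  is positive on the positive half-line.  Where the denominator is positive, the left-hand side
  increases and the right-hand side decreases strictly, so the difference has at most one zero, and comparing \<open>\<alpha>\<close> with \<open>b\<close>
  amounts to reading off the signs of the denominator and of the difference at \<open>b\<close> (\<open>tanh_gap_strict_mono\<close>).
  Existence is the intermediate value theorem applied after clearing the denominator.

  The equation for \<open>\<alpha>\<close> and the formula for \<open>A\<close> together say exactly that the hyperbolic
  piece and the payoff \<open>\<lambda>x\<^sup>2\<close> agree to first order at \<open>|x| = \<alpha>\<close> (\<open>value_fit\<close>, \<open>slope_fit\<close>); at
  \<open>|x| = b\<close> the payoff has slope of modulus 1, and the linear piece is its tangent.  Thus \<open>u\<close> is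
  \<open>C\<^sup>1\<close> on the whole line, its derivative is Lipschitz, and the definition is met with
  \<open>\<B> = \<emptyset>\<close>.

  What remains is to locate \<open>u\<close> relative to the payoff.  Both nontrivial facts come from the
  strict increase of \<open>sinh x / x\<close>.  First, the derivative of \<open>u - g\<close> is
  \<open>A r sinh (r x) - (2p/\<delta>) x\<close>, which vanishes at \<open>\<alpha>\<close> and is therefore negative on \<open>(0, \<alpha>)\<close>;
  as \<open>u - g\<close> vanishes at \<open>\<alpha>\<close>, it is positive for \<open>|x| < \<alpha>\<close>
  (\<open>u_wait_above_payoff\<close>).  Secondly, \<open>tanh y < y\<close> at \<open>y = r \<alpha>\<close> turns the equation for \<open>\<alpha>\<close>
  into \<open>p \<alpha>\<^sup>2 \<ge> \<lambda> + \<mu>\<close>, which is the sign condition \<open>\<L>g + h \<le> 0\<close> for \<open>|x| \<ge> \<alpha>\<close>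
  (\<open>boundary_beyond_generator_zero\<close>).  Beyond \<open>b\<close> the tangent lies below the convex payoff.
  Hence the waiting region is \<open>|x| < \<alpha>\<close>, the set \<open>\<S>\<^sub>\<W>\<close> is \<open>\<alpha> \<le> |x| \<le> b\<close>, and
  \<open>\<S>\<^sub>\<C> = \<C>\<close> is \<open>|x| \<ge> b\<close>.
\<close>

section \<open>The equation for the free boundary\<close>

text \<open>Dividing by \<open>x\<close> shows why the quotient decreases: it is \<open>r p / (d p x - q / x)\<close>.\<close>
lemma tanh_gap_strict_mono:
  fixes d p q r x y :: real
  assumes "d > 0" "p > 0" "q > 0" "r > 0" "0 < x" "x < y" and q: "q < d * p * x\<^sup>2"
  shows "tanh (r * x) - r * p * x / (d * p * x\<^sup>2 - q) < tanh (r * y) - r * p * y / (d * p * y\<^sup>2 - q)"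
proof -
  have "x\<^sup>2 < y\<^sup>2" using assms by (intro power_strict_mono) auto
  hence "d * p * x\<^sup>2 < d * p * y\<^sup>2" using assms by simp
  hence y: "q < d * p * y\<^sup>2" using q by linarith
  have "(d * p * x * y + q) * (r * p * (y - x)) > 0"
    using assms by (intro mult_pos_pos add_pos_pos) auto
  hence "r * p * y * (d * p * x\<^sup>2 - q) < r * p * x * (d * p * y\<^sup>2 - q)"
    by (simp add: algebra_simps power2_eq_square)
  hence "r * p * y / (d * p * y\<^sup>2 - q) < r * p * x / (d * p * x\<^sup>2 - q)"
    using q y by (simp add: divide_simps)
  moreover have "tanh (r * x) < tanh (r * y)" using assms by simp
  ultimately show ?thesis by linarith
qed

text \<open>The left-hand side is positive, so the quotient must be; this also disposes of the case of
  a vanishing denominator, where the quotient is 0.\<close>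
lemma tanh_root_denominator_pos:
  fixes d p q r x :: real
  assumes "p > 0" "r > 0" "x > 0"
    and eq: "tanh (r * x) = r * p * x / (d * p * x\<^sup>2 - q)"
  shows "q < d * p * x\<^sup>2"
proof -
  have "0 < r * p * x / (d * p * x\<^sup>2 - q)" using assms(1-3) unfolding eq[symmetric] by simp
  thus ?thesis using assms(1-3) by (simp add: zero_less_divide_iff) (smt (verit) mult_pos_pos)
qed

text \<open>Multiplying by the denominator removes the pole at \<open>\<surd>(q / (d p))\<close>, so that the
  intermediate value theorem applies from the pole onwards.\<close>
lemma tanh_root_exists:
  fixes d p q r :: real
  assumes pos: "d > 0" "p > 0" "q > 0" "r > 0"
  shows "\<exists>x>0. tanh (r * x) = r * p * x / (d * p * x\<^sup>2 - q)"
proof -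
  define G where "G x = tanh (r * x) * (d * p * x\<^sup>2 - q) - r * p * x" for x
  define s where "s = sqrt (q / (d * p))"
  define t where "t = tanh r"
  \<comment> \<open>For \<open>M \<ge> 1\<close> the factor \<open>tanh (r M)\<close> is at least \<open>t\<close>; the last summand of \<open>M\<close> makes
     \<open>t d p M\<^sup>2\<close> dominate \<open>(r p + t q) M \<ge> r p M + t q\<close>, whence \<open>G M \<ge> 0\<close>.\<close>
  define M where "M = 1 + s + (r * p + t * q) / (t * d * p)"
  have t: "t > 0" using pos by (simp add: t_def)
  have s: "s > 0" "d * p * s\<^sup>2 = q" using pos by (simp_all add: s_def)
  have M1: "1 \<le> M" "s \<le> M" using pos t s by (simp_all add: M_def add_nonneg_nonneg)
  have "(r * p + t * q) / (t * d * p) \<le> M" using s by (simp add: M_def)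
  hence M2: "r * p + t * q \<le> t * d * p * M"
    using pos t by (simp add: divide_le_eq mult_ac)
  have Gs: "G s < 0" using pos s by (simp add: G_def)
  have "q = d * p * s\<^sup>2" using s by simp
  also have "\<dots> \<le> d * p * M\<^sup>2" using pos s M1 by (intro mult_left_mono power_mono) auto
  finally have qM: "q \<le> d * p * M\<^sup>2" .
  have "r * p * M + t * q \<le> (r * p + t * q) * M"
    using M1 t pos by (simp add: algebra_simps)
  also have "\<dots> \<le> t * d * p * M * M" using M1 by (intro mult_right_mono M2) auto
  finally have "r * p * M \<le> t * (d * p * M\<^sup>2 - q)" by (simp add: algebra_simps power2_eq_square)
  also have "\<dots> \<le> tanh (r * M) * (d * p * M\<^sup>2 - q)"
    using M1 pos qM by (intro mult_right_mono) (simp_all add: t_def)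
  finally have GM: "0 \<le> G M" by (simp add: G_def)
  have "continuous_on {s..M} G" unfolding G_def by (intro continuous_intros) auto
  from IVT'[of G s 0 M, OF _ GM M1(2) this] Gs
  obtain x where x: "s \<le> x" "G x = 0" by auto
  with s have x0: "x > 0" by linarith
  have "tanh (r * x) * (d * p * x\<^sup>2 - q) = r * p * x" using x by (simp add: G_def)
  moreover from this have "d * p * x\<^sup>2 - q \<noteq> 0" using x0 pos by auto
  ultimately have "tanh (r * x) = r * p * x / (d * p * x\<^sup>2 - q)" by (simp add: eq_divide_eq)
  with x0 show ?thesis by blast
qed

lemma sqrt_less_iff_denominator_pos:
  fixes d p q x :: real
  assumes "d > 0" "p > 0" "x > 0"
  shows "sqrt (q / (d * p)) < x \<longleftrightarrow> q < d * p * x\<^sup>2"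
proof -
  have "sqrt (q / (d * p)) < x \<longleftrightarrow> sqrt (q / (d * p)) < sqrt (x\<^sup>2)" using assms by simp
  also have "\<dots> \<longleftrightarrow> q < d * p * x\<^sup>2"
    unfolding real_sqrt_less_iff using assms by (simp add: divide_less_eq mult_ac)
  finally show ?thesis .
qed

section \<open>Hyperbolic sine and its chords\<close>

text \<open>By the mean value theorem \<open>sinh x / x\<close> is a value of \<open>cosh\<close> at a point below \<open>x\<close>.\<close>
lemma sinh_less_mult_cosh:
  fixes x :: real
  assumes "x > 0"
  shows "sinh x < x * cosh x"
proof -
  have "\<exists>z. 0 < z \<and> z < x \<and> sinh x - sinh 0 = (x - 0) * cosh z"
    using assms by (intro MVT2) (auto intro!: derivative_eq_intros)
  then obtain z where "0 < z" "z < x" "sinh x = x * cosh z" by auto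
  thus ?thesis using cosh_real_strict_mono[of z x] assms by simp
qed

text \<open>Slopes of chords from the origin increase because \<open>sinh\<close> is convex on the positive half-line.
  This is the form in which convexity enters the comparison of \<open>u\<close> with the payoff.\<close>
lemma sinh_div_strict_mono:
  fixes x y :: real
  assumes "0 < x" "x < y"
  shows "sinh x / x < sinh y / y"
proof (rule DERIV_pos_imp_increasing[OF assms(2)])
  fix z assume z: "x \<le> z" "z \<le> y"
  hence "z > 0" using assms by linarith
  hence "((\<lambda>z. sinh z / z) has_real_derivative (cosh z * z - sinh z) / z\<^sup>2) (at z)"
    by (auto intro!: derivative_eq_intros simp: power2_eq_square)
  moreover have "(cosh z * z - sinh z) / z\<^sup>2 > 0"
    using sinh_less_mult_cosh[OF \<open>z > 0\<close>] \<open>z > 0\<close> by (simp add: mult.commute)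
  ultimately show "\<exists>D. ((\<lambda>z. sinh z / z) has_real_derivative D) (at z) \<and> 0 < D" by blast
qed

section \<open>Regularity of functions glued along symmetric intervals\<close>

text \<open>Smooth fit: the points \<open>\<plusminus>c\<close> are the only ones at which both branches matter, and there the
  branches agree to first order.\<close>
lemma has_real_derivative_If_abs:
  fixes f g f' g' :: "real \<Rightarrow> real"
  assumes f: "\<And>x. \<bar>x\<bar> \<le> c \<Longrightarrow> (f has_real_derivative f' x) (at x)"
    and g: "\<And>x. c \<le> \<bar>x\<bar> \<Longrightarrow> (g has_real_derivative g' x) (at x)"
    and fit: "\<And>x. \<bar>x\<bar> = c \<Longrightarrow> f x = g x \<and> f' x = g' x"
  shows "((\<lambda>x. if \<bar>x\<bar> \<le> c then f x else g x) has_real_derivative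
    (if \<bar>x\<bar> \<le> c then f' x else g' x)) (at x)"
proof -
  define S where "S = {x::real. \<bar>x\<bar> \<le> c}"
  define T where "T = {x::real. c < \<bar>x\<bar>}"
  have S: "closure S = S"
    unfolding S_def by (intro closure_closed closed_Collect_le continuous_intros)
  have T: "closure T \<subseteq> {x. c \<le> \<bar>x\<bar>}"
    unfolding T_def by (intro closure_minimal closed_Collect_le continuous_intros) auto
  have ST: "UNIV = S \<union> T" by (auto simp: S_def T_def)
  have "((\<lambda>x. if x \<in> S then f x else g x) has_vector_derivative
    (if x \<in> S then f' x else g' x)) (at x within UNIV)"
  proof (rule has_vector_derivative_If_within_closures[OF _ ST])
    show "x \<in> S \<union> T" using ST by blast
  next
    assume "x \<in> S \<union> closure S \<inter> closure T"
    hence "\<bar>x\<bar> \<le> c" using S by (auto simp: S_def)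
    from f[OF this] show "(f has_vector_derivative f' x) (at x within S \<union> closure S \<inter> closure T)"
      by (simp add: has_real_derivative_iff_has_vector_derivative has_vector_derivative_at_within)
  next
    assume "x \<in> T \<union> closure S \<inter> closure T"
    hence "c \<le> \<bar>x\<bar>" using T by (auto simp: T_def)
    from g[OF this] show "(g has_vector_derivative g' x) (at x within T \<union> closure S \<inter> closure T)"
      by (simp add: has_real_derivative_iff_has_vector_derivative has_vector_derivative_at_within)
  next
    assume "x \<in> closure S" "x \<in> closure T"
    hence "\<bar>x\<bar> = c" using S T by (auto simp: S_def)
    from fit[OF this] show "f x = g x" "f' x = g' x" by auto
  qed
  thus ?thesis by (simp add: has_real_derivative_iff_has_vector_derivative S_def)
qed

text \<open>The sum of increments is at most \<open>L\<close> times the total length; the modulus uses \<open>L + 1\<close> to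
  cover \<open>L = 0\<close>.\<close>
lemma abs_cont_inside_lipschitz:
  assumes "L-lipschitz_on UNIV f"
  shows "abs_cont_inside U f"
  unfolding abs_cont_inside_def abs_cont_on_interval_def
proof (intro allI impI, elim conjE)
  fix a b e :: real assume e: "e > 0"
  have L: "L \<ge> 0" using assms lipschitz_on_nonneg by blast
  show "\<exists>d>0. \<forall>(n::nat) s t.
       (\<forall>i<n. a \<le> s i \<and> s i \<le> t i \<and> t i \<le> b) \<and>
       (\<forall>i<n. \<forall>j<n. i \<noteq> j \<longrightarrow> {s i<..<t i} \<inter> {s j<..<t j} = {}) \<and>
       (\<Sum>i<n. t i - s i) < d \<longrightarrow> (\<Sum>i<n. \<bar>f (t i) - f (s i)\<bar>) < e"
  proof (intro exI[of _ "e / (L + 1)"] conjI allI impI, goal_cases)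
    case 1 show ?case using e L by simp
  next
    case (2 n s t)
    have "(\<Sum>i<n. \<bar>f (t i) - f (s i)\<bar>) \<le> (\<Sum>i<n. (L + 1) * (t i - s i))"
    proof (rule sum_mono)
      fix i assume "i \<in> {..<n}"
      with 2 have st: "s i \<le> t i" by auto
      have "\<bar>f (t i) - f (s i)\<bar> \<le> L * \<bar>t i - s i\<bar>"
        using lipschitz_onD[OF assms, of "t i" "s i"] by (simp add: dist_real_def)
      also have "\<dots> \<le> (L + 1) * (t i - s i)" using st by (simp add: algebra_simps)
      finally show "\<bar>f (t i) - f (s i)\<bar> \<le> (L + 1) * (t i - s i)" .
    qed
    also have "\<dots> = (L + 1) * (\<Sum>i<n. t i - s i)" by (simp add: sum_distrib_left)
    also have "\<dots> < e" using 2 L by (simp add: less_divide_eq mult.commute)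
    finally show ?case .
  qed
qed

text \<open>Projection of the line onto \<open>[-c, c]\<close>, for \<open>c \<ge> 0\<close>.  Precomposing with it extends a function
  from that interval by constants, without increasing a Lipschitz constant.\<close>
definition truncate_at :: "real \<Rightarrow> real \<Rightarrow> real" where
  "truncate_at c x = max (-c) (min c x)"

lemma lipschitz_truncate_at: "1-lipschitz_on UNIV (truncate_at c)"
  by (rule lipschitz_onI) (auto simp: truncate_at_def dist_real_def max_def min_def)

text \<open>For discarding \<open>\<plusminus>\<alpha>\<close> and \<open>\<plusminus>b\<close>, so that the interiors of the regions need not be computed.\<close>
lemma AE_lebesgue_off_finite:
  fixes F :: "real set"
  assumes "finite F" "\<And>x. x \<notin> F \<Longrightarrow> P x"
  shows "AE x in lebesgue. P x"
proof -
  have "F \<in> null_sets lebesgue"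
    using assms(1) by (intro null_sets_completionI finite_imp_null_set_lborel)
  from AE_not_in[OF this] show ?thesis by eventually_elim (use assms(2) in blast)
qed

section \<open>Smooth fit of the candidate\<close>

locale free_boundary =
  fixes \<delta> \<kappa> lam \<mu> \<alpha> :: real
  assumes \<delta>: "\<delta> > 0" and \<kappa>: "\<kappa> > 0" and lam: "lam > 0" and \<mu>: "\<mu> \<ge> 0"
    and p: "\<delta> * lam - \<kappa> > 0" and \<alpha>: "\<alpha> > 0"
    and root: "alpha_eq \<delta> \<kappa> lam \<mu> \<alpha>" and \<alpha>_le: "\<alpha> \<le> 1 / (2 * lam)"
begin

definition r where "r = sqrt (2 * \<delta>)"
definition b where "b = 1 / (2 * lam)"

abbreviation A where "A \<equiv> A_const \<delta> \<kappa> lam \<mu> \<alpha>"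
abbreviation u where "u \<equiv> u_quad \<delta> \<kappa> lam \<mu> \<alpha>"

text \<open>The piece of \<open>u\<close> on the waiting region: a particular solution of \<open>\<L>w + h = 0\<close> plus the
  even homogeneous solution \<open>A cosh (r x)\<close>.\<close>
definition u_wait where
  "u_wait x = A * cosh (r * x) + \<kappa> / \<delta> * x\<^sup>2 + (\<kappa> + \<delta> * \<mu>) / \<delta>\<^sup>2"

definition u_wait' where "u_wait' x = A * r * sinh (r * x) + 2 * \<kappa> / \<delta> * x"

definition u' where
  "u' x = (if \<bar>x\<bar> \<le> \<alpha> then u_wait' x else if \<bar>x\<bar> \<le> b then 2 * lam * x else sgn x)"

lemma r: "r > 0" "r\<^sup>2 = 2 * \<delta>" using \<delta> by (simp_all add: r_def)
lemma b: "b > 0" "lam * b = 1/2" "\<alpha> \<le> b" using lam \<alpha>_le by (simp_all add: b_def)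

lemma u_eq: "u x = (if \<bar>x\<bar> \<le> \<alpha> then u_wait x else if \<bar>x\<bar> \<le> b then lam * x\<^sup>2 else \<bar>x\<bar> - b / 2)"
  by (simp add: u_quad_def u_wait_def b_def r_def)

lemma root': "tanh (r * \<alpha>) = r * (\<delta> * lam - \<kappa>) * \<alpha> / (\<delta> * (\<delta> * lam - \<kappa>) * \<alpha>\<^sup>2 - (\<kappa> + \<delta> * \<mu>))"
  using root by (simp add: alpha_eq_def r_def)

lemma denominator_pos: "\<kappa> + \<delta> * \<mu> < \<delta> * (\<delta> * lam - \<kappa>) * \<alpha>\<^sup>2"
  using tanh_root_denominator_pos[OF p r(1) \<alpha> root'] .

lemma A_pos: "A > 0"
  using denominator_pos \<delta> by (simp add: A_const_def)

lemma A_cosh: "A * cosh (r * \<alpha>) = (\<delta> * (\<delta> * lam - \<kappa>) * \<alpha>\<^sup>2 - (\<kappa> + \<delta> * \<mu>)) / \<delta>\<^sup>2"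
proof -
  have "cosh (r * \<alpha>) \<noteq> 0" by simp
  thus ?thesis using \<delta> by (simp add: A_const_def r_def[symmetric])
qed

text \<open>Here the equation for \<open>\<alpha>\<close> is used: dividing \<open>A r sinh (r \<alpha>)\<close> by \<open>A cosh (r \<alpha>)\<close> leaves
  \<open>r tanh (r \<alpha>)\<close>, whose denominator cancels the numerator of \<open>A\<close>.\<close>
lemma A_sinh: "A * r * sinh (r * \<alpha>) = 2 * (\<delta> * lam - \<kappa>) / \<delta> * \<alpha>"
proof -
  have "sinh (r * \<alpha>) = tanh (r * \<alpha>) * cosh (r * \<alpha>)" by (simp add: tanh_def)
  hence "A * r * sinh (r * \<alpha>) = (A * cosh (r * \<alpha>)) * r * tanh (r * \<alpha>)" by simp
  also have "\<dots> = r\<^sup>2 * (\<delta> * lam - \<kappa>) * \<alpha> / \<delta>\<^sup>2"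
    unfolding A_cosh root' using denominator_pos by (simp add: power2_eq_square)
  also have "\<dots> = 2 * (\<delta> * lam - \<kappa>) / \<delta> * \<alpha>"
    unfolding r using \<delta> by (simp add: power2_eq_square)
  finally show ?thesis .
qed

lemma value_fit: "\<bar>x\<bar> = \<alpha> \<Longrightarrow> u_wait x = lam * x\<^sup>2"
proof -
  assume x: "\<bar>x\<bar> = \<alpha>"
  have c: "cosh (r * x) = cosh (r * \<alpha>)" and s: "x\<^sup>2 = \<alpha>\<^sup>2"
    using x by (auto simp: abs_if split: if_splits)
  show ?thesis unfolding u_wait_def c s A_cosh using less_imp_neq[OF \<delta>]
    by (simp add: field_simps power2_eq_square)
qed

lemma u_wait'_minus: "u_wait' (-x) = - u_wait' x"
  by (simp add: u_wait'_def)

lemma slope_fit: "\<bar>x\<bar> = \<alpha> \<Longrightarrow> u_wait' x = 2 * lam * x"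
proof -
  assume x: "\<bar>x\<bar> = \<alpha>"
  have "u_wait' \<alpha> = 2 * lam * \<alpha>"
    unfolding u_wait'_def A_sinh using less_imp_neq[OF \<delta>]
    by (simp add: field_simps)
  thus ?thesis using x u_wait'_minus[of \<alpha>] by (auto simp: abs_if split: if_splits)
qed

lemma DERIV_u_wait: "(u_wait has_real_derivative u_wait' x) (at x)"
  unfolding u_wait_def[abs_def] u_wait'_def using \<delta> by (auto intro!: derivative_eq_intros)

lemma DERIV_u_wait': "(u_wait' has_real_derivative A * r\<^sup>2 * cosh (r * x) + 2 * \<kappa> / \<delta>) (at x)"
  unfolding u_wait'_def[abs_def] using \<delta> by (auto intro!: derivative_eq_intros simp: power2_eq_square)

lemma strict_mono_u_wait': "strict_mono u_wait'"
proof (rule strict_monoI)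
  fix x y :: real assume "x < y"
  hence "A * r * sinh (r * x) < A * r * sinh (r * y)" "2 * \<kappa> / \<delta> * x < 2 * \<kappa> / \<delta> * y"
    using A_pos r \<kappa> \<delta> by (auto intro!: mult_strict_left_mono divide_strict_right_mono)
  thus "u_wait' x < u_wait' y" by (simp add: u_wait'_def)
qed

lemma DERIV_u: "(u has_real_derivative u' x) (at x)"
proof -
  have outer: "((\<lambda>x. if \<bar>x\<bar> \<le> b then lam * x\<^sup>2 else \<bar>x\<bar> - b / 2) has_real_derivative
    (if \<bar>y\<bar> \<le> b then 2 * lam * y else sgn y)) (at y)" for y
  proof (rule has_real_derivative_If_abs)
    show "((\<lambda>x. lam * x\<^sup>2) has_real_derivative 2 * lam * x) (at x)" for x
      by (auto intro!: derivative_eq_intros)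
    show "((\<lambda>x. \<bar>x\<bar> - b / 2) has_real_derivative sgn x) (at x)" if "b \<le> \<bar>x\<bar>" for x
    proof -
      have "x \<noteq> 0" using that b by auto
      have "(abs has_real_derivative sgn x) (at x)"
        using has_derivative_norm[OF \<open>x \<noteq> 0\<close>]
        by (simp add: has_field_derivative_def real_norm_def[abs_def] mult.commute[of _ "sgn x"])
      from DERIV_diff[OF this DERIV_const] show ?thesis by simp
    qed
    fix x :: real assume "\<bar>x\<bar> = b"
    hence "x = b \<or> x = -b" by linarith
    thus "lam * x\<^sup>2 = \<bar>x\<bar> - b / 2 \<and> 2 * lam * x = sgn x"
      using b(1,2) by (auto simp: power2_eq_square)
  qed
  have "((\<lambda>x. if \<bar>x\<bar> \<le> \<alpha> then u_wait x else if \<bar>x\<bar> \<le> b then lam * x\<^sup>2 else \<bar>x\<bar> - b / 2)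
    has_real_derivative u' x) (at x)"
    unfolding u'_def using b(3)
    by (intro has_real_derivative_If_abs outer DERIV_u_wait) (simp add: value_fit slope_fit)
  thus ?thesis by (simp add: u_eq[abs_def])
qed

lemma deriv_u: "deriv u = u'"
  using DERIV_imp_deriv[OF DERIV_u] by blast

text \<open>A formula without case distinction that exhibits \<open>u'\<close> as a sum of Lipschitz functions:
  the slope at the nearest point of \<open>[-\<alpha>, \<alpha>]\<close>, plus the increase gathered between \<open>\<alpha>\<close> and \<open>b\<close>.\<close>
lemma u'_eq_truncate:
  "u' x = u_wait' (truncate_at \<alpha> x) + 2 * lam * (truncate_at b x - truncate_at \<alpha> x)"
proof -
  have "u_wait' \<alpha> = 2 * lam * \<alpha>" "u_wait' (-\<alpha>) = - (2 * lam * \<alpha>)" using \<alpha> by (simp_all add: slope_fit)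
  moreover have "lam * (2 * b) = 1" using b(2) by simp
  ultimately show ?thesis using b(1,3) \<alpha>
    by (auto simp: u'_def truncate_at_def abs_if max_def min_def algebra_simps)
qed

lemma lipschitz_u': "\<exists>L. L-lipschitz_on UNIV u'"
proof -
  define K where "K = A * r\<^sup>2 * cosh (r * \<alpha>) + 2 * \<kappa> / \<delta>"
  have "K-lipschitz_on {-\<alpha>..\<alpha>} u_wait'"
  proof (rule lipschitz_onI)
    show "0 \<le> K" unfolding K_def using A_pos \<kappa> \<delta> by (intro add_nonneg_nonneg mult_nonneg_nonneg) auto
    fix x y assume xy: "x \<in> {-\<alpha>..\<alpha>}" "y \<in> {-\<alpha>..\<alpha>}"
    have "norm (u_wait' x - u_wait' y) \<le> K * norm (x - y)"
    proof (rule field_differentiable_bound[of "{-\<alpha>..\<alpha>}"])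
      fix z assume z: "z \<in> {-\<alpha>..\<alpha>}"
      show "(u_wait' has_real_derivative A * r\<^sup>2 * cosh (r * z) + 2 * \<kappa> / \<delta>) (at z within {-\<alpha>..\<alpha>})"
        using DERIV_u_wait' by (rule has_field_derivative_at_within)
      have "cosh (r * z) = cosh (r * \<bar>z\<bar>)" by (auto simp: abs_if)
      also have "\<dots> \<le> cosh (r * \<alpha>)"
        using z r by (subst cosh_real_nonneg_le_iff) auto
      finally have "A * r\<^sup>2 * cosh (r * z) \<le> A * r\<^sup>2 * cosh (r * \<alpha>)"
        using A_pos by (intro mult_left_mono) auto
      moreover have "0 \<le> A * r\<^sup>2 * cosh (r * z) + 2 * \<kappa> / \<delta>"
        using A_pos \<kappa> \<delta> by (intro add_nonneg_nonneg mult_nonneg_nonneg) auto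
      ultimately show "norm (A * r\<^sup>2 * cosh (r * z) + 2 * \<kappa> / \<delta>) \<le> K" by (simp add: K_def)
    qed (use xy in auto)
    thus "dist (u_wait' x) (u_wait' y) \<le> K * dist x y" by (simp add: dist_norm)
  qed
  hence "K-lipschitz_on (truncate_at \<alpha> ` UNIV) u_wait'"
    by (rule lipschitz_on_subset) (use \<alpha> in \<open>auto simp: truncate_at_def\<close>)
  from lipschitz_on_compose[OF lipschitz_truncate_at this]
  have 1: "(K * 1)-lipschitz_on UNIV (\<lambda>x. u_wait' (truncate_at \<alpha> x))" by (simp add: o_def)
  have "(\<bar>2 * lam\<bar> * (1 + 1))-lipschitz_on UNIV (\<lambda>x. 2 * lam * (truncate_at b x - truncate_at \<alpha> x))"
    by (intro lipschitz_on_cmult_real lipschitz_on_diff lipschitz_truncate_at)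
  from lipschitz_on_add[OF 1 this] show ?thesis by (auto simp: u'_eq_truncate[abs_def])
qed

text \<open>On the waiting region monotonicity bounds the slope by its boundary value \<open>2\<lambda>\<alpha> \<le> 1\<close>;
  strictness is needed to identify the set where \<open>|u'| = 1\<close>.\<close>
lemma abs_u'_less_1: "\<bar>x\<bar> < b \<Longrightarrow> \<bar>u' x\<bar> < 1"
proof -
  assume x: "\<bar>x\<bar> < b"
  have quad: "\<bar>2 * lam * x\<bar> < 1"
  proof -
    have "lam * \<bar>x\<bar> < lam * b" using x lam by simp
    thus ?thesis using lam b(2) by (simp add: abs_mult)
  qed
  consider "\<bar>x\<bar> < \<alpha>" | "\<bar>x\<bar> = \<alpha>" | "\<alpha> < \<bar>x\<bar>" by linarith
  thus ?thesis
  proof cases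
    case 1
    hence "u_wait' (-\<alpha>) < u_wait' x" "u_wait' x < u_wait' \<alpha>"
      using strict_mono_u_wait' by (auto simp: strict_mono_less)
    moreover have "u_wait' \<alpha> \<le> 1"
    proof -
      have "lam * \<alpha> \<le> lam * b" using lam b(3) by simp
      thus ?thesis using \<alpha> b(2) by (simp add: slope_fit)
    qed
    ultimately show ?thesis using 1 by (simp add: u'_def u_wait'_minus)
  qed (use x quad in \<open>simp_all add: u'_def slope_fit\<close>)
qed

lemma abs_u'_eq_1: "b \<le> \<bar>x\<bar> \<Longrightarrow> \<bar>u' x\<bar> = 1"
proof (cases "\<bar>x\<bar> = b")
  case True
  hence "\<bar>2 * lam * x\<bar> = 1" using lam b(2) by (simp add: abs_mult)
  thus ?thesis using True b(3) slope_fit[of x] unfolding u'_def by auto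
next
  case False
  assume "b \<le> \<bar>x\<bar>"
  thus ?thesis using False b by (auto simp: u'_def sgn_if)
qed

section \<open>Position relative to the payoff\<close>

text \<open>The difference \<open>\<phi>\<close> of the waiting value and the payoff vanishes at \<open>\<alpha>\<close>.  It decreases
  strictly on \<open>(0, \<alpha>)\<close>: there the graph of \<open>A r sinh (r x)\<close> lies below its chord from 0 to \<open>\<alpha>\<close>, and by
  \<open>A_sinh\<close> this chord has slope \<open>2(\<delta>\<lambda> - \<kappa>)/\<delta>\<close>.  Evenness covers negative \<open>x\<close>.\<close>
lemma u_wait_above_payoff: "\<bar>x\<bar> < \<alpha> \<Longrightarrow> lam * x\<^sup>2 < u_wait x"
proof -
  assume x: "\<bar>x\<bar> < \<alpha>"
  define \<phi> where "\<phi> x = u_wait x - lam * x\<^sup>2" for x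
  have D: "(\<phi> has_real_derivative u_wait' x - 2 * lam * x) (at x)" for x
    unfolding \<phi>_def by (auto intro!: derivative_eq_intros DERIV_u_wait)
  have neg: "u_wait' z - 2 * lam * z < 0" if z: "0 < z" "z < \<alpha>" for z
  proof -
    have "sinh (r * z) / (r * z) < sinh (r * \<alpha>) / (r * \<alpha>)"
      using z r by (intro sinh_div_strict_mono) auto
    hence "sinh (r * z) < sinh (r * \<alpha>) * z / \<alpha>" using z r by (simp add: field_simps)
    hence "A * r * sinh (r * z) < A * r * (sinh (r * \<alpha>) * z / \<alpha>)"
      using A_pos r by (intro mult_strict_left_mono) auto
    also have "\<dots> = (A * r * sinh (r * \<alpha>)) * z / \<alpha>" by simp
    also have "\<dots> = 2 * (\<delta> * lam - \<kappa>) / \<delta> * z" unfolding A_sinh using \<alpha> by simp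
    also have "\<dots> = 2 * lam * z - 2 * \<kappa> / \<delta> * z" using \<delta> by (simp add: field_simps)
    finally show ?thesis by (simp add: u_wait'_def)
  qed
  have "\<phi> \<alpha> < \<phi> \<bar>x\<bar>"
  proof (rule DERIV_neg_imp_decreasing_open[OF x])
    show "continuous_on {\<bar>x\<bar>..\<alpha>} \<phi>"
      by (rule DERIV_continuous_on) (rule has_field_derivative_at_within[OF D])
    fix z assume "\<bar>x\<bar> < z" "z < \<alpha>"
    thus "\<exists>y. (\<phi> has_real_derivative y) (at z) \<and> y < 0"
      using D[of z] neg[of z] by fastforce
  qed
  moreover have "\<phi> \<alpha> = 0" using value_fit[of \<alpha>] \<alpha> by (simp add: \<phi>_def)
  moreover have "\<phi> \<bar>x\<bar> = \<phi> x" by (cases "x \<ge> 0") (simp_all add: \<phi>_def u_wait_def)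
  ultimately show ?thesis by (simp add: \<phi>_def)
qed

text \<open>The generator inequality \<open>\<L>g + h \<le> 0\<close> reads \<open>\<lambda> + \<mu> \<le> (\<delta>\<lambda> - \<kappa>) x\<^sup>2\<close>.  It holds at \<open>\<alpha>\<close> because
  the difference of the waiting value and the payoff has a nonnegative second derivative where it
  touches 0 from above; analytically this is \<open>sinh y < y cosh y\<close> at \<open>y = r \<alpha>\<close>.\<close>
lemma boundary_beyond_generator_zero: "lam + \<mu> \<le> (\<delta> * lam - \<kappa>) * \<alpha>\<^sup>2"
proof -
  have "sinh (r * \<alpha>) < r * \<alpha> * cosh (r * \<alpha>)" using r \<alpha> by (intro sinh_less_mult_cosh) simp
  hence "A * r * sinh (r * \<alpha>) < A * r * (r * \<alpha> * cosh (r * \<alpha>))"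
    using A_pos r by (intro mult_strict_left_mono) auto
  also have "\<dots> = r\<^sup>2 * \<alpha> * (A * cosh (r * \<alpha>))" by (simp add: power2_eq_square)
  finally have "2 * (\<delta> * lam - \<kappa>) / \<delta> * \<alpha>
      < 2 * (\<delta> * (\<delta> * lam - \<kappa>) * \<alpha>\<^sup>2 - (\<kappa> + \<delta> * \<mu>)) / \<delta> * \<alpha>"
    unfolding A_sinh A_cosh r(2) using \<delta> by (simp add: power2_eq_square mult_ac)
  hence "\<delta> * lam - \<kappa> < \<delta> * (\<delta> * lam - \<kappa>) * \<alpha>\<^sup>2 - (\<kappa> + \<delta> * \<mu>)"
    using \<alpha> \<delta> by (simp add: divide_less_cancel)
  hence "\<delta> * (lam + \<mu>) < \<delta> * ((\<delta> * lam - \<kappa>) * \<alpha>\<^sup>2)" by (simp add: algebra_simps)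
  thus ?thesis using \<delta> by simp
qed

text \<open>The linear piece is the tangent of the payoff at \<open>\<plusminus>b\<close>; the gap is \<open>\<lambda> (|x| - b)\<^sup>2\<close>.\<close>
lemma payoff_above_linear: "b < \<bar>x\<bar> \<Longrightarrow> \<bar>x\<bar> - b / 2 < lam * x\<^sup>2"
proof -
  assume "b < \<bar>x\<bar>"
  hence "0 < lam * (\<bar>x\<bar> - b)\<^sup>2" using lam by simp
  also have "\<dots> = lam * x\<^sup>2 - 2 * (lam * b) * \<bar>x\<bar> + (lam * b) * b"
    by (simp add: power2_eq_square algebra_simps)
  finally show ?thesis by (simp add: b(2))
qed

lemma u_compare:
  "u x = g_quad lam x \<longleftrightarrow> \<alpha> \<le> \<bar>x\<bar> \<and> \<bar>x\<bar> \<le> b"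
  "u x < g_quad lam x \<longleftrightarrow> b < \<bar>x\<bar>"
proof -
  consider "\<bar>x\<bar> < \<alpha>" | "\<bar>x\<bar> = \<alpha>" | "\<alpha> < \<bar>x\<bar>" "\<bar>x\<bar> \<le> b" | "b < \<bar>x\<bar>" by linarith
  note cs = this
  show "u x = g_quad lam x \<longleftrightarrow> \<alpha> \<le> \<bar>x\<bar> \<and> \<bar>x\<bar> \<le> b"
    using cs b(3) u_wait_above_payoff[of x] payoff_above_linear[of x] value_fit[of x]
    by cases (simp_all add: u_eq g_quad_def)
  show "u x < g_quad lam x \<longleftrightarrow> b < \<bar>x\<bar>"
    using cs b(3) u_wait_above_payoff[of x] payoff_above_linear[of x] value_fit[of x]
    by cases (simp_all add: u_eq g_quad_def)
qed

lemma u_nonneg: "0 \<le> u x"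
proof -
  have "0 \<le> u_wait x" unfolding u_wait_def using A_pos \<kappa> \<delta> \<mu> by (intro add_nonneg_nonneg mult_nonneg_nonneg) auto
  thus ?thesis using b(1) lam by (simp add: u_eq)
qed

section \<open>Regions and generator inequalities\<close>

lemma closure_exterior: "closure {x. b < \<bar>x\<bar>} = {x. b \<le> \<bar>x\<bar>}"
proof -
  have "{x. b < \<bar>x\<bar>} = {..<-b} \<union> {b<..}" using b(1) by auto
  moreover have "{x. b \<le> \<bar>x\<bar>} = {..-b} \<union> {b..}" using b(1) by auto
  ultimately show ?thesis by (simp add: closure_Un)
qed

lemma region_SW_eq: "region_SW (g_quad lam) u = {x. \<alpha> \<le> \<bar>x\<bar> \<and> \<bar>x\<bar> \<le> b}"
  by (simp add: region_SW_def u_compare)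

lemma region_SC_eq: "region_SC (g_quad lam) u = {x. b \<le> \<bar>x\<bar>}"
  by (simp add: region_SC_def u_compare closure_exterior)

text \<open>The set where \<open>|u'| = 1\<close> is \<open>|x| \<ge> b\<close>, which equals the closure of its interior: it is closed,
  and the open subset \<open>|x| > b\<close> is dense in it.\<close>
lemma region_C_eq: "region_C {} u = {x. b \<le> \<bar>x\<bar>}"
proof -
  have "{x \<in> UNIV - {}. \<bar>deriv u x\<bar> = 1} = {x. b \<le> \<bar>x\<bar>}"
    using abs_u'_less_1 abs_u'_eq_1 unfolding deriv_u by (force simp: not_le[symmetric])
  also have "\<dots> = {..-b} \<union> {b..}" using b(1) by auto
  finally have eq: "{x \<in> UNIV - {}. \<bar>deriv u x\<bar> = 1} = {..-b} \<union> {b..}" .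
  have "{x. b < \<bar>x\<bar>} \<subseteq> interior ({..-b} \<union> {b..})"
  proof (rule interior_maximal)
    show "open {x. b < \<bar>x\<bar>}" by (intro open_Collect_less continuous_intros)
  qed auto
  hence "closure {x. b < \<bar>x\<bar>} \<subseteq> region_C {} u"
    unfolding region_C_def eq by (rule closure_mono)
  moreover have "region_C {} u \<subseteq> {..-b} \<union> {b..}"
    unfolding region_C_def eq by (intro closure_minimal interior_subset closed_Un) auto
  ultimately show ?thesis using b(1) unfolding closure_exterior by fastforce
qed

text \<open>The second derivative is local, so on an open piece it may be read off from the formula \<open>w\<close>
  for \<open>u'\<close> there.\<close>
lemma has_second_deriv_u:
  assumes "open S" "x \<in> S" "\<And>y. y \<in> S \<Longrightarrow> u' y = w y" "(w has_real_derivative D) (at x)"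
  shows "has_second_deriv u x" "deriv (deriv u) x = D"
proof -
  have "(u' has_real_derivative D) (at x)"
    using has_field_derivative_transform_within_open[OF assms(4,1,2)] assms(3) by metis
  moreover have "u differentiable (at y)" for y
    using DERIV_u real_differentiable_def by blast
  ultimately show "has_second_deriv u x" "deriv (deriv u) x = D"
    unfolding has_second_deriv_def deriv_u
    by (auto simp: real_differentiable_def DERIV_imp_deriv)
qed

lemma second_deriv_payoff:
  "has_second_deriv (g_quad lam) x" "deriv (deriv (g_quad lam)) x = 2 * lam"
proof -
  have D: "(g_quad lam has_real_derivative 2 * lam * x) (at x)" for x
    unfolding g_quad_def by (auto intro!: derivative_eq_intros)
  hence d: "deriv (g_quad lam) = (\<lambda>x. 2 * lam * x)" using DERIV_imp_deriv by blast
  have "((\<lambda>x. 2 * lam * x) has_real_derivative 2 * lam) (at x)"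
    by (auto intro!: derivative_eq_intros)
  thus "has_second_deriv (g_quad lam) x" "deriv (deriv (g_quad lam)) x = 2 * lam"
    unfolding has_second_deriv_def d
    using D unfolding real_differentiable_def by (blast intro: DERIV_imp_deriv always_eventually)+
qed

lemma waiting_equation:
  assumes "\<bar>x\<bar> < \<alpha>"
  shows "has_second_deriv u x" "Lop \<delta> u x + h_quad \<kappa> \<mu> x = 0"
proof -
  have o: "open {y. \<bar>y\<bar> < \<alpha>}" by (intro open_Collect_less continuous_intros)
  note sd = has_second_deriv_u[OF o _ _ DERIV_u_wait', of x, unfolded u'_def, simplified, OF assms]
  show "has_second_deriv u x" using sd(1) .
  have "Lop \<delta> u x + h_quad \<kappa> \<mu> x =
    1/2 * (A * (2 * \<delta>) * cosh (r * x) + 2 * \<kappa> / \<delta>) - \<delta> * u_wait x + (\<kappa> * x\<^sup>2 + \<mu>)"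
    using assms unfolding Lop_def h_quad_def sd(2) by (simp add: u_eq r(2))
  also have "\<dots> = 0" unfolding u_wait_def using \<delta> by (simp add: field_simps power2_eq_square)
  finally show "Lop \<delta> u x + h_quad \<kappa> \<mu> x = 0" .
qed

lemma stopping_inequality:
  assumes "\<alpha> < \<bar>x\<bar>" "\<bar>x\<bar> < b"
  shows "has_second_deriv u x" "Lop \<delta> u x = Lop \<delta> (g_quad lam) x"
    "Lop \<delta> (g_quad lam) x + h_quad \<kappa> \<mu> x \<le> 0"
proof -
  have o: "open {y. \<alpha> < \<bar>y\<bar> \<and> \<bar>y\<bar> < b}"
    by (intro open_Collect_conj open_Collect_less continuous_intros)
  have D: "((\<lambda>x. 2 * lam * x) has_real_derivative 2 * lam) (at x)"
    by (auto intro!: derivative_eq_intros)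
  note sd = has_second_deriv_u[OF o _ _ D, unfolded u'_def, simplified, OF conjI[OF assms]]
  show "has_second_deriv u x" using sd(1) .
  show "Lop \<delta> u x = Lop \<delta> (g_quad lam) x"
    using assms u_compare(1)[of x] by (simp add: Lop_def sd(2) second_deriv_payoff)
  have "(\<delta> * lam - \<kappa>) * \<alpha>\<^sup>2 \<le> (\<delta> * lam - \<kappa>) * x\<^sup>2"
    using p \<alpha> assms by (intro mult_left_mono) (auto simp: abs_le_square_iff[symmetric])
  with boundary_beyond_generator_zero show "Lop \<delta> (g_quad lam) x + h_quad \<kappa> \<mu> x \<le> 0"
    by (simp add: Lop_def second_deriv_payoff g_quad_def h_quad_def algebra_simps)
qed

lemma control_second_deriv:
  assumes "b < \<bar>x\<bar>"
  shows "has_second_deriv u x"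
proof (rule has_second_deriv_u(1))
  \<comment> \<open>The factor \<open>x * y\<close> keeps to the half-line of \<open>x\<close>, on which \<open>sgn\<close> is constant.\<close>
  show "open {y. b < \<bar>y\<bar> \<and> 0 < x * y}"
    by (intro open_Collect_conj open_Collect_less continuous_intros)
  show "x \<in> {y. b < \<bar>y\<bar> \<and> 0 < x * y}" using assms b(1) by (auto simp: zero_less_mult_iff)
  show "((\<lambda>y. sgn x) has_real_derivative 0) (at x)" by simp
  show "u' y = sgn x" if "y \<in> {y. b < \<bar>y\<bar> \<and> 0 < x * y}" for y
    using that b(3) by (auto simp: u'_def zero_less_mult_iff)
qed

theorem candidate_u: "candidate \<delta> (h_quad \<kappa> \<mu>) (g_quad lam) u"
proof -
  define E where "E = {-\<alpha>, \<alpha>, -b, b}"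
  have fE: "finite E" by (simp add: E_def)
  have E: "\<bar>x\<bar> \<noteq> \<alpha>" "\<bar>x\<bar> \<noteq> b" if "x \<notin> E" for x
    using that by (auto simp: E_def abs_if split: if_splits)
  obtain L where L: "L-lipschitz_on UNIV u'" using lipschitz_u' by blast
  have ext: "finite_union_of_intervals {x. b \<le> \<bar>x\<bar>}"
    unfolding finite_union_of_intervals_def using b(1)
    by (intro exI[of _ "{{..-b}, {b..}}"]) (auto simp: is_interval_ic is_interval_ci)
  have mid: "finite_union_of_intervals {x. \<alpha> \<le> \<bar>x\<bar> \<and> \<bar>x\<bar> \<le> b}"
    unfolding finite_union_of_intervals_def using \<alpha>
    by (intro exI[of _ "{{-b..-\<alpha>}, {\<alpha>..b}}"]) (auto simp: is_interval_cc)
  have W: "region_W {} (g_quad lam) u = {x. \<bar>x\<bar> < \<alpha>}"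
    unfolding region_W_def region_S_def region_C_eq region_SW_eq region_SC_eq using b(3) by auto
  have CS: "region_C {} u - region_S (g_quad lam) u = {}"
    unfolding region_S_def region_C_eq region_SC_eq by auto
  have "candidate_with {} \<delta> (h_quad \<kappa> \<mu>) (g_quad lam) u"
    unfolding candidate_with_def
  proof (intro conjI)
    show "continuous_on UNIV u" by (rule DERIV_continuous_on) (rule DERIV_u)
    show "C1_abs_cont_inside (UNIV - {}) u"
      unfolding C1_abs_cont_inside_def deriv_u
      using DERIV_u abs_cont_inside_lipschitz[OF L] lipschitz_on_continuous_on[OF L]
      by (auto simp: real_differentiable_def)
    show "\<forall>x\<in>UNIV - {}. \<bar>deriv u x\<bar> \<le> 1"
      unfolding deriv_u using abs_u'_less_1 abs_u'_eq_1 by (metis less_imp_le not_le order_refl)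
    show "AE x in lebesgue. x \<in> region_W {} (g_quad lam) u \<longrightarrow>
        has_second_deriv u x \<and> Lop \<delta> u x + h_quad \<kappa> \<mu> x = 0"
      unfolding W using waiting_equation by simp
    show "AE x in lebesgue. x \<in> interior (region_C {} u - region_S (g_quad lam) u) \<longrightarrow>
        has_second_deriv u x \<and> Lop \<delta> u x + h_quad \<kappa> \<mu> x \<ge> 0"
      unfolding CS by simp
    show "AE x in lebesgue. x \<in> interior (region_SW (g_quad lam) u) \<longrightarrow>
        has_second_deriv u x \<and> has_second_deriv (g_quad lam) x \<and>
        Lop \<delta> u x + h_quad \<kappa> \<mu> x = Lop \<delta> (g_quad lam) x + h_quad \<kappa> \<mu> x \<and>
        Lop \<delta> (g_quad lam) x + h_quad \<kappa> \<mu> x \<le> 0"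
    proof (intro AE_lebesgue_off_finite[OF fE] impI)
      fix x assume "x \<notin> E" "x \<in> interior (region_SW (g_quad lam) u)"
      hence "\<alpha> < \<bar>x\<bar>" "\<bar>x\<bar> < b"
        using E[of x] interior_subset by (force simp: region_SW_eq)+
      from stopping_inequality[OF this] second_deriv_payoff
      show "has_second_deriv u x \<and> has_second_deriv (g_quad lam) x \<and>
        Lop \<delta> u x + h_quad \<kappa> \<mu> x = Lop \<delta> (g_quad lam) x + h_quad \<kappa> \<mu> x \<and>
        Lop \<delta> (g_quad lam) x + h_quad \<kappa> \<mu> x \<le> 0" by simp
    qed
    show "AE x in lebesgue. x \<in> interior (region_SC (g_quad lam) u) - {} \<longrightarrow> has_second_deriv u x"
    proof (intro AE_lebesgue_off_finite[OF fE] impI)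
      fix x assume "x \<notin> E" "x \<in> interior (region_SC (g_quad lam) u) - {}"
      hence "b < \<bar>x\<bar>" using E[of x] interior_subset by (force simp: region_SC_eq)
      thus "has_second_deriv u x" by (rule control_second_deriv)
    qed
  qed (simp_all add: u_nonneg region_C_eq region_SW_eq region_SC_eq ext mid)
  thus ?thesis unfolding candidate_def by blast
qed

end

theorem proposition3:
  fixes \<delta> \<kappa> lam \<mu> :: real
  assumes "\<delta> > 0" and "\<kappa> > 0" and "lam > 0" and "\<mu> \<ge> 0"
    and "\<delta> * lam - \<kappa> > 0"
  shows "(\<exists>!\<alpha>. \<alpha> > 0 \<and> alpha_eq \<delta> \<kappa> lam \<mu> \<alpha>) \<and>
    (\<forall>\<alpha>. \<alpha> > 0 \<and> alpha_eq \<delta> \<kappa> lam \<mu> \<alpha> \<longrightarrow>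
       \<alpha> > sqrt ((\<kappa> + \<delta>*\<mu>) / (\<delta> * (\<delta>*lam - \<kappa>))) \<and>
       (\<alpha> \<le> 1/(2*lam) \<longleftrightarrow>
          1/(2*lam) > sqrt ((\<kappa> + \<delta>*\<mu>) / (\<delta> * (\<delta>*lam - \<kappa>))) \<and>
          tanh (sqrt (2*\<delta>) / (2*lam)) \<ge>
            sqrt (2*\<delta>) * (\<delta>*lam - \<kappa>) * (2*lam) /
              (\<delta> * (\<delta>*lam - \<kappa>) - 4 * (\<kappa> + \<delta>*\<mu>) * lam\<^sup>2)) \<and>
       (\<alpha> \<le> 1/(2*lam) \<longrightarrow>
          A_const \<delta> \<kappa> lam \<mu> \<alpha> > 0 \<and>
          candidate \<delta> (h_quad \<kappa> \<mu>) (g_quad lam) (u_quad \<delta> \<kappa> lam \<mu> \<alpha>)))"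
proof -
  define p where "p = \<delta> * lam - \<kappa>"
  define q where "q = \<kappa> + \<delta> * \<mu>"
  define r where "r = sqrt (2 * \<delta>)"
  define b where "b = 1 / (2 * lam)"
  have pos: "p > 0" "q > 0" "r > 0" "b > 0" using assms by (auto simp: p_def q_def r_def b_def add_pos_nonneg)
  define gap where "gap x = tanh (r * x) - r * p * x / (\<delta> * p * x\<^sup>2 - q)" for x
  have eq: "alpha_eq \<delta> \<kappa> lam \<mu> x \<longleftrightarrow> gap x = 0" for x
    unfolding alpha_eq_def gap_def p_def q_def r_def by auto
  have den: "q < \<delta> * p * x\<^sup>2" if "x > 0" "gap x = 0" for x
    using tanh_root_denominator_pos[of p r x \<delta> q] that pos by (simp add: gap_def)
  have mono: "gap x < gap y" if "0 < x" "x < y" "q < \<delta> * p * x\<^sup>2" for x y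
    unfolding gap_def by (rule tanh_gap_strict_mono) (use that pos assms in auto)
  have uniq: "x = y" if "x > 0" "gap x = 0" "y > 0" "gap y = 0" for x y
    using mono[of x y] mono[of y x] den[of x] den[of y] that by (cases x y rule: linorder_cases) auto
  have ex: "\<exists>x>0. gap x = 0"
    using tanh_root_exists[of \<delta> p q r] pos assms by (simp add: gap_def)
  have sq: "sqrt (q / (\<delta> * p)) < x \<longleftrightarrow> q < \<delta> * p * x\<^sup>2" if "x > 0" for x
    using sqrt_less_iff_denominator_pos that assms pos by blast
  \<comment> \<open>The right-hand side of the criterion is that of the equation at \<open>b\<close>, expanded by \<open>4\<lambda>\<^sup>2\<close>.\<close>
  have rhs: "r * p * (2 * lam) / (\<delta> * p - 4 * q * lam\<^sup>2) = r * p * b / (\<delta> * p * b\<^sup>2 - q)"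
  proof -
    have "r * p * b / (\<delta> * p * b\<^sup>2 - q) = (4 * lam\<^sup>2 * (r * p * b)) / (4 * lam\<^sup>2 * (\<delta> * p * b\<^sup>2 - q))"
      using assms by simp
    also have "4 * lam\<^sup>2 * (r * p * b) = r * p * (2 * lam)"
      using assms by (simp add: b_def power2_eq_square)
    also have "4 * lam\<^sup>2 * (\<delta> * p * b\<^sup>2 - q) = \<delta> * p - 4 * q * lam\<^sup>2"
      using assms by (simp add: b_def power2_eq_square field_simps)
    finally show ?thesis ..
  qed
  have tb: "tanh (r / (2 * lam)) = tanh (r * b)" by (simp add: b_def)
  have crit: "x \<le> b \<longleftrightarrow> sqrt (q / (\<delta> * p)) < b \<and>
      r * p * (2 * lam) / (\<delta> * p - 4 * q * lam\<^sup>2) \<le> tanh (r / (2 * lam))"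
    if x: "x > 0" "gap x = 0" for x
  proof -
    have "x \<le> b \<longleftrightarrow> q < \<delta> * p * b\<^sup>2 \<and> 0 \<le> gap b"
    proof
      assume xb: "x \<le> b"
      have "\<delta> * p * x\<^sup>2 \<le> \<delta> * p * b\<^sup>2"
        using xb x assms pos by (intro mult_left_mono power_mono) auto
      thus "q < \<delta> * p * b\<^sup>2 \<and> 0 \<le> gap b"
        using den[OF x] mono[of x b] x xb by (cases "x = b") auto
    next
      assume "q < \<delta> * p * b\<^sup>2 \<and> 0 \<le> gap b"
      thus "x \<le> b" using mono[of b x] pos x by (cases "x \<le> b") auto
    qed
    thus ?thesis unfolding sq[OF pos(4)] rhs tb gap_def by simp
  qed
  have cand: "A_const \<delta> \<kappa> lam \<mu> x > 0 \<and> candidate \<delta> (h_quad \<kappa> \<mu>) (g_quad lam) (u_quad \<delta> \<kappa> lam \<mu> x)"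
    if x: "x > 0" "gap x = 0" "x \<le> b" for x
  proof -
    interpret free_boundary \<delta> \<kappa> lam \<mu> x
      by unfold_locales (use assms x eq in \<open>auto simp: b_def\<close>)
    show ?thesis using A_pos candidate_u by blast
  qed
  show ?thesis
    unfolding eq p_def[symmetric] q_def[symmetric] r_def[symmetric] b_def[symmetric]
    using ex uniq den sq crit cand by blast
qed

end
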